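(* Let $k\geq1$ and $\overrightarrow C=(C_{\bar a})_{\bar a\in A^k}\in X_k$. Then: (1) for any $\bar p=(p_1,\dots,p_k)\in\mathbb N^k$ and $\bar a=(a_1,\dots,a_k)\in A^k$, $\bar p\in Cont(C_{\bar a})$ if and only if for every $j\in\{1,\dots,k\}$, $(p_j,\dots,p_j)\in Cont(C_{(a_j,\dots,a_j)})$. (2) For $a\in A$ let $C^{\mathbb N}_a:=\pi_1(Cont(C_{(a,\dots,a)}))\subseteq\mathbb N$, where $\pi_1:\mathbb N^k\to\mathbb N$ is the projection on the first coordinate. Then the sets $(C^{\mathbb N}_a)_{a\in A}$ are pairwise disjoint and their union is a downset of $\mathbb N$, and for every $\bar a\in A^k$, $Cont(C_{\bar a})=\prod_{j=1}^k C^{\mathbb N}_{a_j}$.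
   Context: $A$ is a finite alphabet. $\beta(\mathbb N^k)$ is the space of ultrafilters on $\mathbb N^k$, containing $\mathbb N^k$ as the principal ultrafilters; for a closed $C\subseteq\beta(\mathbb N^k)$, $Cont(C):=C\cap\mathbb N^k$. $V_k:=\mathcal V(\beta(\mathbb N^k))^{A^k}$, $\mathcal V$ the Vietoris hyperspace of closed subsets. For $\bar a\in A^k$, $w\in A^*$, $c_{\bar a}(w):=\{\bar i\in\mathbb N^k: i_j<|w|, w_{i_j}=a_j\ \forall j\}$; $c^k:\beta(A^* )\to V_k$ is the continuous extension of $w\mapsto(\widehat{c_{\bar a}(w)})_{\bar a}$ (where $\widehat Q=\{\alpha: Q\in\alpha\}$), and $X_k:=c^k(\beta(A^* ))$, the dual space of the Boolean algebra generated by the languages $\{w: c_{\bar a}(w)\cap Q\neq\emptyset\}$. *)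

theory Defs
  imports "HOL-Analysis.Analysis"
begin

definition ultrafilter_on :: "'s set \<Rightarrow> 's set set \<Rightarrow> bool" where
  "ultrafilter_on S \<mu> \<longleftrightarrow>
     \<mu> \<subseteq> Pow S \<and> S \<in> \<mu> \<and> {} \<notin> \<mu> \<and>
     (\<forall>P\<in>\<mu>. \<forall>Q\<in>\<mu>. P \<inter> Q \<in> \<mu>) \<and>
     (\<forall>P\<in>\<mu>. \<forall>Q. P \<subseteq> Q \<and> Q \<subseteq> S \<longrightarrow> Q \<in> \<mu>) \<and>
     (\<forall>Q\<subseteq>S. Q \<in> \<mu> \<or> S - Q \<in> \<mu>)"

definition beta :: "'s set \<Rightarrow> 's set set set" where
  "beta S = {\<mu>. ultrafilter_on S \<mu>}"

definition hat :: "'s set \<Rightarrow> 's set \<Rightarrow> 's set set set" where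
  "hat S Q = {\<mu> \<in> beta S. Q \<in> \<mu>}"

definition principal_uf :: "'s set \<Rightarrow> 's \<Rightarrow> 's set set" where
  "principal_uf S s = {Q. Q \<subseteq> S \<and> s \<in> Q}"

definition beta_topology :: "'s set \<Rightarrow> 's set set topology" where
  "beta_topology S = topology_generated_by {hat S Q | Q. Q \<subseteq> S}"

text \<open>The continuous extension to \<open>\<beta>S\<close> of a map from the discrete set \<open>S\<close> to a topological space
  \<open>Y\<close>; it exists and is unique when \<open>Y\<close> is compact Hausdorff. Extensionality fixes the
  values outside \<open>\<beta>S\<close>, without which the description would never be unique.\<close>

definition beta_extension :: "'s set \<Rightarrow> 'y topology \<Rightarrow> ('s \<Rightarrow> 'y) \<Rightarrow> 's set set \<Rightarrow> 'y" where
  "beta_extension S Y f =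
     (THE g. g \<in> extensional (beta S) \<and> continuous_map (beta_topology S) Y g \<and>
             (\<forall>s\<in>S. g (principal_uf S s) = f s))"

text \<open>The empty set is a point of the hyperspace.\<close>

definition vietoris :: "'x topology \<Rightarrow> 'x set topology" where
  "vietoris X = topology_generated_by
     ({{C. closedin X C \<and> C \<subseteq> U} | U. openin X U} \<union>
      {{C. closedin X C \<and> C \<inter> U \<noteq> {}} | U. openin X U})"

text \<open>A \<open>k\<close>-tuple over \<open>B\<close> is an extensional function on \<open>{1..k}\<close>; positions in words start at \<open>0\<close>.\<close>

definition tuples :: "nat \<Rightarrow> 'b set \<Rightarrow> (nat \<Rightarrow> 'b) set" where
  "tuples k B = {1..k} \<rightarrow>\<^sub>E B"

definition const_tuple :: "nat \<Rightarrow> 'b \<Rightarrow> nat \<Rightarrow> 'b" where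
  "const_tuple k b = (\<lambda>j\<in>{1..k}. b)"

abbreviation Nk :: "nat \<Rightarrow> (nat \<Rightarrow> nat) set" where
  "Nk k \<equiv> tuples k UNIV"

definition V_space :: "'a set \<Rightarrow> nat \<Rightarrow> ((nat \<Rightarrow> 'a) \<Rightarrow> (nat \<Rightarrow> nat) set set set) topology" where
  "V_space A k = product_topology (\<lambda>a. vietoris (beta_topology (Nk k))) (tuples k A)"

definition c_word :: "nat \<Rightarrow> (nat \<Rightarrow> 'a) \<Rightarrow> 'a list \<Rightarrow> (nat \<Rightarrow> nat) set" where
  "c_word k a w = {i \<in> Nk k. \<forall>j\<in>{1..k}. i j < length w \<and> w ! i j = a j}"

definition c_map ::
  "'a set \<Rightarrow> nat \<Rightarrow> 'a list set set \<Rightarrow> (nat \<Rightarrow> 'a) \<Rightarrow> (nat \<Rightarrow> nat) set set set" where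
  "c_map A k = beta_extension (lists A) (V_space A k)
     (\<lambda>w. \<lambda>a\<in>tuples k A. hat (Nk k) (c_word k a w))"

definition X_space :: "'a set \<Rightarrow> nat \<Rightarrow> ((nat \<Rightarrow> 'a) \<Rightarrow> (nat \<Rightarrow> nat) set set set) set" where
  "X_space A k = c_map A k ` beta (lists A)"

text \<open>\<open>C \<inter> \<nat>\<^sup>k\<close>, with \<open>\<nat>\<^sup>k\<close> identified with the principal ultrafilters in \<open>\<beta>(\<nat>\<^sup>k)\<close>.\<close>

definition Cont :: "nat \<Rightarrow> (nat \<Rightarrow> nat) set set set \<Rightarrow> (nat \<Rightarrow> nat) set" where
  "Cont k C = {p \<in> Nk k. principal_uf (Nk k) p \<in> C}"

definition C_nat :: "nat \<Rightarrow> ((nat \<Rightarrow> 'a) \<Rightarrow> (nat \<Rightarrow> nat) set set set) \<Rightarrow> 'a \<Rightarrow> nat set" where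
  "C_nat k C a = (\<lambda>p. p 1) ` Cont k (C (const_tuple k a))"

definition downset :: "nat set \<Rightarrow> bool" where
  "downset D \<longleftrightarrow> (\<forall>n\<in>D. \<forall>m\<le>n. m \<in> D)"

end

theory Submission
  imports Defs
begin

text \<open>The continuous extension \<open>c\<^sup>k\<close> has an explicit form: \<open>c\<^sup>k(\<mu>)\<^sub>a\<close> consists of the ultrafilters
  \<open>\<nu>\<close> such that, for every \<open>Q \<in> \<nu>\<close>, \<open>\<mu>\<close>-almost all words \<open>w\<close> satisfy \<open>c\<^sub>a(w) \<inter> Q \<noteq> \<emptyset>\<close>.
  For a principal \<open>\<nu>\<close> this says that \<open>p \<in> Cont(C\<^sub>a)\<close> iff \<open>p \<in> c\<^sub>a(w)\<close> for \<open>\<mu>\<close>-almost all \<open>w\<close>, and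
  each claim becomes a property of single words transported through the ultrafilter \<open>\<mu>\<close>,
  finiteness of the alphabet being used for the downset property.\<close>

section \<open>Ultrafilters\<close>

lemma ultrafilter_onD:
  assumes "ultrafilter_on S \<mu>"
  shows ultrafilter_on_subset: "Q \<in> \<mu> \<Longrightarrow> Q \<subseteq> S"
    and ultrafilter_on_space: "S \<in> \<mu>"
    and ultrafilter_on_empty: "{} \<notin> \<mu>"
    and ultrafilter_on_Int: "P \<in> \<mu> \<Longrightarrow> Q \<in> \<mu> \<Longrightarrow> P \<inter> Q \<in> \<mu>"
    and ultrafilter_on_mono: "P \<in> \<mu> \<Longrightarrow> P \<subseteq> Q \<Longrightarrow> Q \<subseteq> S \<Longrightarrow> Q \<in> \<mu>"
    and ultrafilter_on_cases: "Q \<subseteq> S \<Longrightarrow> Q \<in> \<mu> \<or> S - Q \<in> \<mu>"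
proof -
  have "\<mu> \<subseteq> Pow S" and S: "S \<in> \<mu>" "{} \<notin> \<mu>"
    and Int: "\<forall>P\<in>\<mu>. \<forall>Q\<in>\<mu>. P \<inter> Q \<in> \<mu>"
    and mono: "\<forall>P\<in>\<mu>. \<forall>Q. P \<subseteq> Q \<and> Q \<subseteq> S \<longrightarrow> Q \<in> \<mu>"
    and cases: "\<forall>Q\<subseteq>S. Q \<in> \<mu> \<or> S - Q \<in> \<mu>"
    using assms unfolding ultrafilter_on_def by simp_all
  then show "Q \<in> \<mu> \<Longrightarrow> Q \<subseteq> S" by blast
  show "S \<in> \<mu>" "{} \<notin> \<mu>" by (fact S)+
  show "P \<in> \<mu> \<Longrightarrow> Q \<in> \<mu> \<Longrightarrow> P \<inter> Q \<in> \<mu>" using Int by simp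
  show "P \<in> \<mu> \<Longrightarrow> P \<subseteq> Q \<Longrightarrow> Q \<subseteq> S \<Longrightarrow> Q \<in> \<mu>" using mono by simp
  show "Q \<subseteq> S \<Longrightarrow> Q \<in> \<mu> \<or> S - Q \<in> \<mu>" using cases by simp
qed

lemma ultrafilter_on_Diff_iff:
  assumes "ultrafilter_on S \<mu>" "Q \<subseteq> S"
  shows "S - Q \<in> \<mu> \<longleftrightarrow> Q \<notin> \<mu>"
proof -
  have "\<not> (Q \<in> \<mu> \<and> S - Q \<in> \<mu>)"
    using ultrafilter_on_Int[OF assms(1), of Q "S - Q"] ultrafilter_on_empty[OF assms(1)] by auto
  then show ?thesis
    using ultrafilter_on_cases[OF assms] by blast
qed

lemma ultrafilter_on_Un:
  assumes \<mu>: "ultrafilter_on S \<mu>" and "P \<subseteq> S" "Q \<subseteq> S" "P \<union> Q \<in> \<mu>"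
  shows "P \<in> \<mu> \<or> Q \<in> \<mu>"
proof (rule ccontr)
  assume "\<not> (P \<in> \<mu> \<or> Q \<in> \<mu>)"
  then have "S - P \<in> \<mu>" "S - Q \<in> \<mu>"
    using assms by (auto simp: ultrafilter_on_Diff_iff)
  then have "(P \<union> Q) \<inter> ((S - P) \<inter> (S - Q)) \<in> \<mu>"
    by (intro ultrafilter_on_Int[OF \<mu>] assms(4))
  moreover have "(P \<union> Q) \<inter> ((S - P) \<inter> (S - Q)) = {}"
    by blast
  ultimately show False
    using ultrafilter_on_empty[OF \<mu>] by simp
qed

text \<open>Iterates the binary case. In the downset claim it selects, among the finitely many
  letters, one that almost all words carry at a given position.\<close>

lemma ultrafilter_on_UN:
  assumes \<mu>: "ultrafilter_on S \<mu>" and "finite I" and "\<And>i. i \<in> I \<Longrightarrow> F i \<subseteq> S"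
    and "(\<Union>i\<in>I. F i) \<in> \<mu>"
  shows "\<exists>i\<in>I. F i \<in> \<mu>"
  using assms(2-4)
proof (induction I rule: finite_induct)
  case empty
  then show ?case using ultrafilter_on_empty[OF \<mu>] by simp
next
  case (insert x I)
  have "F x \<in> \<mu> \<or> (\<Union>i\<in>I. F i) \<in> \<mu>"
    by (rule ultrafilter_on_Un[OF \<mu>]) (use insert.prems in auto)
  then show ?case using insert by auto
qed

text \<open>Membership in an ultrafilter commutes with finite intersections. This is what later
  splits a condition on a \<open>k\<close>-tuple of positions into \<open>k\<close> independent
  conditions.\<close>

lemma ultrafilter_on_ball:
  assumes \<mu>: "ultrafilter_on S \<mu>" and "finite I"
  shows "{x\<in>S. \<forall>i\<in>I. P i x} \<in> \<mu> \<longleftrightarrow> (\<forall>i\<in>I. {x\<in>S. P i x} \<in> \<mu>)"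
  using assms(2)
proof (induction I rule: finite_induct)
  case empty
  then show ?case using ultrafilter_on_space[OF \<mu>] by simp
next
  case (insert j I)
  have eq: "{x\<in>S. \<forall>i\<in>insert j I. P i x} = {x\<in>S. P j x} \<inter> {x\<in>S. \<forall>i\<in>I. P i x}"
    by auto
  have "X \<inter> Y \<in> \<mu> \<longleftrightarrow> X \<in> \<mu> \<and> Y \<in> \<mu>" if "X \<subseteq> S" "Y \<subseteq> S" for X Y
    using that ultrafilter_on_Int[OF \<mu>, of X Y] ultrafilter_on_mono[OF \<mu>, of "X \<inter> Y" X]
      ultrafilter_on_mono[OF \<mu>, of "X \<inter> Y" Y] by auto
  then show ?case
    unfolding eq using insert.IH by simp
qed

lemma principal_uf_in_beta: "s \<in> S \<Longrightarrow> principal_uf S s \<in> beta S"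
  unfolding beta_def ultrafilter_on_def principal_uf_def by auto

section \<open>Proper ideals of sets and the ultrafilters avoiding them\<close>

definition set_ideal :: "'s set \<Rightarrow> 's set set \<Rightarrow> bool" where
  "set_ideal S I \<longleftrightarrow> I \<subseteq> Pow S \<and> {} \<in> I \<and> S \<notin> I \<and>
     (\<forall>P\<in>I. \<forall>Q\<in>I. P \<union> Q \<in> I) \<and> (\<forall>P\<in>I. \<forall>Q\<subseteq>P. Q \<in> I)"

text \<open>Zorn's lemma: the union of a nonempty chain of proper ideals is again one. It stays
  proper because \<open>S\<close> in the union would lie in a member of the chain.\<close>

lemma set_ideal_maximal_exists:
  assumes "set_ideal S I"
  obtains M where "set_ideal S M" "I \<subseteq> M" "\<And>J. set_ideal S J \<Longrightarrow> M \<subseteq> J \<Longrightarrow> J = M"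
proof -
  let ?\<A> = "{J. set_ideal S J \<and> I \<subseteq> J}"
  have "\<exists>M\<in>?\<A>. \<forall>X\<in>?\<A>. M \<subseteq> X \<longrightarrow> X = M"
  proof (rule subset_Zorn_nonempty)
    show "?\<A> \<noteq> {}" using assms by blast
  next
    fix \<C> assume ne: "\<C> \<noteq> {}" and ch: "subset.chain ?\<A> \<C>"
    have sub: "\<C> \<subseteq> ?\<A>" and tot: "\<And>X Y. X \<in> \<C> \<Longrightarrow> Y \<in> \<C> \<Longrightarrow> X \<subseteq> Y \<or> Y \<subseteq> X"
      using ch by (auto simp: subset_chain_def)
    have id: "\<And>X. X \<in> \<C> \<Longrightarrow> set_ideal S X" using sub by blast
    have un: "P \<union> Q \<in> \<Union>\<C>" if PQ: "P \<in> \<Union>\<C>" "Q \<in> \<Union>\<C>" for P Q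
    proof -
      obtain X Y where XY: "X \<in> \<C>" "P \<in> X" "Y \<in> \<C>" "Q \<in> Y" using PQ by blast
      from tot[OF XY(1,3)] obtain Z where "Z \<in> \<C>" "P \<in> Z" "Q \<in> Z"
        using XY by blast
      then show ?thesis using id[of Z] unfolding set_ideal_def by blast
    qed
    have "set_ideal S (\<Union>\<C>)"
      unfolding set_ideal_def
    proof (intro conjI)
      show "\<Union>\<C> \<subseteq> Pow S" using id unfolding set_ideal_def by blast
      show "{} \<in> \<Union>\<C>" using id ne unfolding set_ideal_def by blast
      show "S \<notin> \<Union>\<C>" using id unfolding set_ideal_def by blast
      show "\<forall>P\<in>\<Union>\<C>. \<forall>Q\<in>\<Union>\<C>. P \<union> Q \<in> \<Union>\<C>" using un by blast
      show "\<forall>P\<in>\<Union>\<C>. \<forall>Q\<subseteq>P. Q \<in> \<Union>\<C>" using id unfolding set_ideal_def by blast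
    qed
    then show "\<Union>\<C> \<in> ?\<A>" using sub ne by blast
  qed
  then obtain M where "M \<in> ?\<A>" and max: "\<forall>X\<in>?\<A>. M \<subseteq> X \<longrightarrow> X = M" by (rule bexE)
  then have "set_ideal S M" "I \<subseteq> M" by simp_all
  moreover have "J = M" if "set_ideal S J" "M \<subseteq> J" for J
    using max that \<open>I \<subseteq> M\<close> by simp
  ultimately show ?thesis by (rule that)
qed

text \<open>A maximal proper ideal contains \<open>Q\<close> or its complement, so its own
  complement in \<open>Pow S\<close> is an ultrafilter. Ideals are the convenient input because the
  sets that an ultrafilter has to avoid below are closed under unions and subsets.\<close>

lemma set_ideal_avoiding_ultrafilter:
  assumes "set_ideal S I"
  obtains \<nu> where "\<nu> \<in> beta S" "\<nu> \<inter> I = {}"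
proof -
  obtain M where M: "set_ideal S M" "I \<subseteq> M" and max: "\<And>J. set_ideal S J \<Longrightarrow> M \<subseteq> J \<Longrightarrow> J = M"
    using set_ideal_maximal_exists[OF assms] by metis
  have Msub: "\<And>P. P \<in> M \<Longrightarrow> P \<subseteq> S" and Mempty: "{} \<in> M" and MS: "S \<notin> M"
    and MUn: "\<And>P Q. P \<in> M \<Longrightarrow> Q \<in> M \<Longrightarrow> P \<union> Q \<in> M"
    and Mmono: "\<And>P Q. P \<in> M \<Longrightarrow> Q \<subseteq> P \<Longrightarrow> Q \<in> M"
    using M(1) unfolding set_ideal_def by blast+
  have compl: "S - Q \<in> M" if Q: "Q \<subseteq> S" "Q \<notin> M" for Q
  proof (rule ccontr)
    assume nin: "S - Q \<notin> M"
    \<comment> \<open>The ideal generated by \<open>M\<close> and \<open>Q\<close>. It is proper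
      exactly because \<open>S - Q\<close> is assumed to lie outside \<open>M\<close>, so maximality
      forces \<open>Q\<close> into \<open>M\<close>.\<close>
    let ?J = "{R. R \<subseteq> S \<and> R - Q \<in> M}"
    have "set_ideal S ?J"
      unfolding set_ideal_def
    proof (intro conjI ballI allI impI)
      fix P R assume "P \<in> ?J" "R \<in> ?J"
      then show "P \<union> R \<in> ?J" using MUn[of "P - Q" "R - Q"] by (simp add: Un_Diff)
    next
      fix P R assume "P \<in> ?J" "R \<subseteq> P"
      then show "R \<in> ?J" using Mmono[of "P - Q" "R - Q"] by auto
    qed (use nin Mempty in auto)
    moreover have "M \<subseteq> ?J" using Msub Mmono by blast
    ultimately have "?J = M" by (rule max)
    then show False using Q Mempty by auto
  qed
  let ?\<nu> = "Pow S - M"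
  have "ultrafilter_on S ?\<nu>"
    unfolding ultrafilter_on_def
  proof (intro conjI ballI allI impI)
    fix P Q assume PQ: "P \<in> ?\<nu>" "Q \<in> ?\<nu>"
    have "P \<inter> Q \<notin> M"
    proof
      assume "P \<inter> Q \<in> M"
      then have "(P \<inter> Q) \<union> ((S - P) \<union> (S - Q)) \<in> M"
        using PQ compl[of P] compl[of Q] by (intro MUn) auto
      moreover have "(P \<inter> Q) \<union> ((S - P) \<union> (S - Q)) = S" using PQ by blast
      ultimately show False using MS by simp
    qed
    then show "P \<inter> Q \<in> ?\<nu>" using PQ by blast
  next
    fix Q assume "Q \<subseteq> S"
    show "Q \<in> ?\<nu> \<or> S - Q \<in> ?\<nu>"
    proof (rule ccontr)
      assume "\<not> (Q \<in> ?\<nu> \<or> S - Q \<in> ?\<nu>)"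
      then have "Q \<union> (S - Q) \<in> M" using \<open>Q \<subseteq> S\<close> MUn[of Q "S - Q"] by blast
      then show False using MS \<open>Q \<subseteq> S\<close> by (simp add: Un_absorb1)
    qed
  next
    fix P Q assume "P \<in> ?\<nu>" "P \<subseteq> Q \<and> Q \<subseteq> S"
    then show "Q \<in> ?\<nu>" using Mmono[of Q P] by blast
  qed (use Mempty MS in auto)
  then have "?\<nu> \<in> beta S" by (simp add: beta_def)
  then show ?thesis using that M(2) by blast
qed

section \<open>Topology of the space of ultrafilters and of its hyperspace\<close>

lemma topspace_beta_topology [simp]: "topspace (beta_topology S) = beta S"
proof -
  have "beta S = hat S S"
    unfolding hat_def beta_def by (auto simp: ultrafilter_on_space)
  then have "beta S \<in> {hat S Q | Q. Q \<subseteq> S}" by blast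
  then show ?thesis
    unfolding beta_topology_def topology_generated_by_topspace by (auto simp: hat_def)
qed

lemma openin_hat: "Q \<subseteq> S \<Longrightarrow> openin (beta_topology S) (hat S Q)"
  unfolding beta_topology_def by (rule topology_generated_by_Basis) blast

lemma hat_Diff: "Q \<subseteq> S \<Longrightarrow> hat S (S - Q) = beta S - hat S Q"
  unfolding hat_def beta_def by (auto simp: ultrafilter_on_Diff_iff)

lemma closedin_hat: "Q \<subseteq> S \<Longrightarrow> closedin (beta_topology S) (hat S Q)"
  using openin_hat[of "S - Q" S] hat_Diff[of Q S] by (auto simp: closedin_def hat_def)

lemma hat_Int: "P \<subseteq> S \<Longrightarrow> Q \<subseteq> S \<Longrightarrow> hat S P \<inter> hat S Q = hat S (P \<inter> Q)"
  unfolding hat_def beta_def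
  by (auto intro: ultrafilter_on_Int elim: ultrafilter_on_mono)

text \<open>The sets \<open>hat S Q\<close> are closed under binary intersection, so these
  generators form a base and not merely a subbase.\<close>

lemma openin_beta_topologyE:
  assumes "openin (beta_topology S) U" "\<nu> \<in> U"
  obtains Q where "Q \<subseteq> S" "\<nu> \<in> hat S Q" "hat S Q \<subseteq> U"
proof -
  have "generate_topology_on {hat S Q | Q. Q \<subseteq> S} U"
    using assms(1) unfolding beta_topology_def openin_topology_generated_by_iff .
  then have "\<forall>\<nu>\<in>U. \<exists>Q\<subseteq>S. \<nu> \<in> hat S Q \<and> hat S Q \<subseteq> U"
  proof (induction rule: generate_topology_on.induct)
    case (Int U V)
    show ?case
    proof
      fix \<nu> assume "\<nu> \<in> U \<inter> V"
      then obtain P Q where "P \<subseteq> S" "\<nu> \<in> hat S P" "hat S P \<subseteq> U"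
        "Q \<subseteq> S" "\<nu> \<in> hat S Q" "hat S Q \<subseteq> V"
        using Int.IH by (metis IntD1 IntD2)
      then show "\<exists>Q\<subseteq>S. \<nu> \<in> hat S Q \<and> hat S Q \<subseteq> U \<inter> V"
        using hat_Int[of P S Q] by (intro exI[of _ "P \<inter> Q"]) blast
    qed
  next
    case (UN K)
    show ?case
    proof
      fix \<nu> assume "\<nu> \<in> \<Union>K"
      then obtain V where V: "V \<in> K" "\<nu> \<in> V" by blast
      then obtain Q where "Q \<subseteq> S" "\<nu> \<in> hat S Q" "hat S Q \<subseteq> V" using UN.IH by metis
      then show "\<exists>Q\<subseteq>S. \<nu> \<in> hat S Q \<and> hat S Q \<subseteq> \<Union>K" using V(1) by blast
    qed
  qed auto
  then obtain Q where "Q \<subseteq> S" "\<nu> \<in> hat S Q" "hat S Q \<subseteq> U" using assms(2) by metis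
  then show ?thesis by (rule that)
qed

text \<open>A nonempty basic open set \<open>hat S Q\<close> has \<open>Q\<close> nonempty and
  contains the principal ultrafilter at each point of \<open>Q\<close>. This density gives
  uniqueness of continuous extensions.\<close>

lemma closure_of_principal_ufs:
  "beta_topology S closure_of (principal_uf S ` S) = beta S"
proof (intro equalityI subsetI)
  fix \<nu> assume "\<nu> \<in> beta_topology S closure_of (principal_uf S ` S)"
  then show "\<nu> \<in> beta S" by (simp add: in_closure_of)
next
  fix \<nu> assume \<nu>: "\<nu> \<in> beta S"
  have "\<exists>y\<in>principal_uf S ` S. y \<in> U" if U: "\<nu> \<in> U" "openin (beta_topology S) U" for U
  proof -
    obtain Q where Q: "Q \<subseteq> S" "\<nu> \<in> hat S Q" "hat S Q \<subseteq> U"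
      using openin_beta_topologyE[OF U(2,1)] by blast
    then have "Q \<noteq> {}"
      unfolding hat_def beta_def by (auto simp: ultrafilter_on_empty)
    then obtain s where s: "s \<in> Q" by blast
    then have "principal_uf S s \<in> hat S Q"
      using Q(1) principal_uf_in_beta[of s S] by (auto simp: hat_def principal_uf_def)
    then show ?thesis using Q s by blast
  qed
  then show "\<nu> \<in> beta_topology S closure_of (principal_uf S ` S)"
    using \<nu> unfolding in_closure_of by auto
qed

section \<open>The Vietoris hyperspace and uniqueness of extensions into Hausdorff spaces\<close>

lemma openin_vietoris_subset:
  "openin X U \<Longrightarrow> openin (vietoris X) {C. closedin X C \<and> C \<subseteq> U}"
  unfolding vietoris_def by (rule topology_generated_by_Basis) blast

lemma openin_vietoris_meets:
  "openin X U \<Longrightarrow> openin (vietoris X) {C. closedin X C \<and> C \<inter> U \<noteq> {}}"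
  unfolding vietoris_def by (rule topology_generated_by_Basis) blast

lemma topspace_vietoris [simp]: "topspace (vietoris X) = {C. closedin X C}"
proof
  show "topspace (vietoris X) \<subseteq> {C. closedin X C}"
    unfolding vietoris_def topology_generated_by_topspace by blast
  show "{C. closedin X C} \<subseteq> topspace (vietoris X)"
    using openin_subset[OF openin_vietoris_subset[OF openin_topspace[of X]]]
      closedin_subset[of X] by blast
qed

text \<open>If \<nu> lies in one closed set but not in the other, some clopen \<open>hat S Q\<close>
  around \<nu> misses the other. Meeting \<open>hat S Q\<close> and being contained in its
  complement are then disjoint Vietoris-open conditions.\<close>

lemma Hausdorff_space_vietoris_beta: "Hausdorff_space (vietoris (beta_topology S))"
proof -
  let ?X = "beta_topology S"
  have sep: "\<exists>U V. openin (vietoris ?X) U \<and> openin (vietoris ?X) V \<and> C \<in> U \<and> D \<in> V \<and> disjnt U V"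
    if C: "closedin ?X C" and D: "closedin ?X D" and \<nu>: "\<nu> \<in> C" "\<nu> \<notin> D" for C D \<nu>
  proof -
    have "\<nu> \<in> beta S - D" using closedin_subset[OF C] \<nu> by auto
    moreover have "openin ?X (beta S - D)" using D by (simp add: closedin_def)
    ultimately obtain Q where Q: "Q \<subseteq> S" "\<nu> \<in> hat S Q" "hat S Q \<subseteq> beta S - D"
      using openin_beta_topologyE by metis
    let ?U = "{E. closedin ?X E \<and> E \<inter> hat S Q \<noteq> {}}"
    let ?V = "{E. closedin ?X E \<and> E \<subseteq> hat S (S - Q)}"
    have "openin (vietoris ?X) ?U" "openin (vietoris ?X) ?V"
      using Q(1) by (auto intro!: openin_vietoris_meets openin_vietoris_subset openin_hat)
    moreover have "C \<in> ?U" using C \<nu> Q by blast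
    moreover have "D \<in> ?V"
      using D Q closedin_subset[OF D] by (auto simp: hat_Diff)
    moreover have "disjnt ?U ?V"
      using hat_Diff[OF Q(1)] by (auto simp: disjnt_def)
    ultimately show ?thesis by blast
  qed
  show ?thesis
    unfolding Hausdorff_space_def
  proof (intro allI impI, elim conjE)
    fix C D assume "C \<in> topspace (vietoris ?X)" "D \<in> topspace (vietoris ?X)" "C \<noteq> D"
    then have CD: "closedin ?X C" "closedin ?X D" and "(\<exists>\<nu>. \<nu> \<in> C \<and> \<nu> \<notin> D) \<or> (\<exists>\<nu>. \<nu> \<in> D \<and> \<nu> \<notin> C)"
      by auto
    then show "\<exists>U V. openin (vietoris ?X) U \<and> openin (vietoris ?X) V \<and> C \<in> U \<and> D \<in> V \<and> disjnt U V"
      using sep[of C D] sep[of D C] by (metis disjnt_sym)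
  qed
qed

text \<open>Existence is witnessed by \<open>g\<close> itself. For uniqueness, continuous maps into
  a Hausdorff space that agree on the dense set of principal ultrafilters agree on
  \<open>beta S\<close>, and extensionality settles the other arguments.\<close>

lemma beta_extension_eqI:
  assumes "Hausdorff_space Y" and "g \<in> extensional (beta S)"
    and "continuous_map (beta_topology S) Y g"
    and "\<And>s. s \<in> S \<Longrightarrow> g (principal_uf S s) = f s"
  shows "beta_extension S Y f = g"
  unfolding beta_extension_def
proof (rule the_equality)
  fix h assume h: "h \<in> extensional (beta S) \<and> continuous_map (beta_topology S) Y h \<and>
             (\<forall>s\<in>S. h (principal_uf S s) = f s)"
  have "h x = g x" if "x \<in> beta S" for x
  proof (rule forall_in_closure_of_eq[of x "beta_topology S" "principal_uf S ` S" Y])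
    show "x \<in> beta_topology S closure_of principal_uf S ` S"
      using that by (simp add: closure_of_principal_ufs)
  qed (use h assms in auto)
  then show "h = g" using h assms(2) by (auto intro: extensionalityI)
qed (use assms in auto)

section \<open>Ultralimits of set-valued maps\<close>

text \<open>For \<mu> in \<open>beta T\<close> and sets \<open>c w\<close> inside \<open>S\<close>,
  this is the limit along \<mu> of the closed sets \<open>hat S (c w)\<close> in the Vietoris
  hyperspace. The lemmas on principal ultrafilters and on continuity below justify this
  reading.\<close>

definition set_ultralimit :: "'t set \<Rightarrow> 's set \<Rightarrow> ('t \<Rightarrow> 's set) \<Rightarrow> 't set set \<Rightarrow> 's set set set" where
  "set_ultralimit T S c \<mu> = {\<nu> \<in> beta S. \<forall>Q\<in>\<nu>. {w \<in> T. c w \<inter> Q \<noteq> {}} \<in> \<mu>}"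

text \<open>Call \<open>Q\<close> null if the set of \<open>w\<close> with \<open>c w\<close>
  meeting \<open>Q\<close> is not in \<mu>. The three claims are the closure properties of an ideal;
  \<open>S\<close> itself may be null, so properness has to be arranged separately in each
  use.\<close>

lemma set_ultralimit_null_ideal:
  assumes "\<mu> \<in> beta T"
  shows "{w \<in> T. c w \<inter> {} \<noteq> {}} \<notin> \<mu>"
    and "{w \<in> T. c w \<inter> P \<noteq> {}} \<notin> \<mu> \<Longrightarrow> {w \<in> T. c w \<inter> Q \<noteq> {}} \<notin> \<mu> \<Longrightarrow>
           {w \<in> T. c w \<inter> (P \<union> Q) \<noteq> {}} \<notin> \<mu>"
    and "{w \<in> T. c w \<inter> P \<noteq> {}} \<notin> \<mu> \<Longrightarrow> Q \<subseteq> P \<Longrightarrow> {w \<in> T. c w \<inter> Q \<noteq> {}} \<notin> \<mu>"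
proof -
  have \<mu>: "ultrafilter_on T \<mu>" using assms by (simp add: beta_def)
  show "{w \<in> T. c w \<inter> {} \<noteq> {}} \<notin> \<mu>" using ultrafilter_on_empty[OF \<mu>] by simp
  have eq: "{w \<in> T. c w \<inter> (P \<union> Q) \<noteq> {}} = {w \<in> T. c w \<inter> P \<noteq> {}} \<union> {w \<in> T. c w \<inter> Q \<noteq> {}}"
    by blast
  show "{w \<in> T. c w \<inter> (P \<union> Q) \<noteq> {}} \<notin> \<mu>"
    if "{w \<in> T. c w \<inter> P \<noteq> {}} \<notin> \<mu>" "{w \<in> T. c w \<inter> Q \<noteq> {}} \<notin> \<mu>"
    using ultrafilter_on_Un[OF \<mu>, of "{w \<in> T. c w \<inter> P \<noteq> {}}" "{w \<in> T. c w \<inter> Q \<noteq> {}}"] that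
    unfolding eq by blast
  show "{w \<in> T. c w \<inter> Q \<noteq> {}} \<notin> \<mu>" if "{w \<in> T. c w \<inter> P \<noteq> {}} \<notin> \<mu>" "Q \<subseteq> P"
    using ultrafilter_on_mono[OF \<mu>, of "{w \<in> T. c w \<inter> Q \<noteq> {}}" "{w \<in> T. c w \<inter> P \<noteq> {}}"] that
    by blast
qed

text \<open>The substance is from right to left: a set \<open>Q\<close> that is not null must be
  extended to an ultrafilter without null members.\<close>

lemma set_ultralimit_meets_hat_iff:
  assumes \<mu>: "\<mu> \<in> beta T" and Q: "Q \<subseteq> S"
  shows "set_ultralimit T S c \<mu> \<inter> hat S Q \<noteq> {} \<longleftrightarrow> {w \<in> T. c w \<inter> Q \<noteq> {}} \<in> \<mu>"
proof
  assume "set_ultralimit T S c \<mu> \<inter> hat S Q \<noteq> {}"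
  then show "{w \<in> T. c w \<inter> Q \<noteq> {}} \<in> \<mu>"
    unfolding set_ultralimit_def hat_def by auto
next
  assume L: "{w \<in> T. c w \<inter> Q \<noteq> {}} \<in> \<mu>"
  \<comment> \<open>The sets whose trace on \<open>Q\<close> is null. The ideal is proper since the
    trace of \<open>S\<close> is \<open>Q\<close>, and it contains \<open>S - Q\<close>, so any
    ultrafilter avoiding it contains \<open>Q\<close>.\<close>
  let ?I = "{R. R \<subseteq> S \<and> {w \<in> T. c w \<inter> (R \<inter> Q) \<noteq> {}} \<notin> \<mu>}"
  note null = set_ultralimit_null_ideal[OF \<mu>, of c]
  have "set_ideal S ?I"
    unfolding set_ideal_def
  proof (intro conjI ballI allI impI)
    show "S \<notin> ?I" using L Q by (simp add: Int_absorb1)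
    show "{} \<in> ?I" using null(1) by simp
    fix P R assume P: "P \<in> ?I"
    show "P \<union> R \<in> ?I" if "R \<in> ?I"
      using null(2)[of "P \<inter> Q" "R \<inter> Q"] P that by (auto simp: Int_Un_distrib2)
    show "R \<in> ?I" if "R \<subseteq> P"
      using null(3)[of "P \<inter> Q" "R \<inter> Q"] P that by auto
  qed auto
  then obtain \<nu> where \<nu>: "\<nu> \<in> beta S" "\<nu> \<inter> ?I = {}"
    by (rule set_ideal_avoiding_ultrafilter)
  have uf: "ultrafilter_on S \<nu>" using \<nu>(1) by (simp add: beta_def)
  have "(S - Q) \<inter> Q = {}" by blast
  then have "S - Q \<in> ?I" using null(1) by simp
  then have "S - Q \<notin> \<nu>" using \<nu>(2) by blast
  then have "Q \<in> \<nu>" using ultrafilter_on_cases[OF uf Q] by blast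
  moreover have "{w \<in> T. c w \<inter> R \<noteq> {}} \<in> \<mu>" if R: "R \<in> \<nu>" for R
  proof -
    have "R \<notin> ?I" "R \<subseteq> S" using R \<nu>(2) ultrafilter_on_subset[OF uf] by blast+
    then show ?thesis using null(3)[of R "R \<inter> Q"] by blast
  qed
  ultimately show "set_ultralimit T S c \<mu> \<inter> hat S Q \<noteq> {}"
    using \<nu>(1) unfolding set_ultralimit_def hat_def by blast
qed

text \<open>A compactness argument: inclusion in \<open>U\<close> is already forced by a single null
  set \<open>Q\<close>. As nullity of \<open>Q\<close> is an open condition on \<mu>, this yields
  continuity for the Vietoris sets given by inclusion.\<close>

lemma set_ultralimit_subset_openE:
  assumes \<mu>: "\<mu> \<in> beta T" and U: "openin (beta_topology S) U" and sub: "set_ultralimit T S c \<mu> \<subseteq> U"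
  obtains Q where "Q \<subseteq> S" "hat S (S - Q) \<subseteq> U" "{w \<in> T. c w \<inter> Q \<noteq> {}} \<notin> \<mu>"
proof (rule ccontr)
  assume "\<not> thesis"
  note found = that
  have none: "{w \<in> T. c w \<inter> Q \<noteq> {}} \<in> \<mu>" if "Q \<subseteq> S" "hat S (S - Q) \<subseteq> U" for Q
    by (rule ccontr) (rule notE[OF \<open>\<not> thesis\<close> found[OF that]])
  let ?N = "\<lambda>Q. {w \<in> T. c w \<inter> Q \<noteq> {}} \<notin> \<mu>"
  note null = set_ultralimit_null_ideal[OF \<mu>, of c]
  \<comment> \<open>the ideal generated by the null sets and the sets \<open>R\<close> with \<open>hat S R \<subseteq> U\<close>; an ultrafilter
    avoiding it would lie in the ultralimit but not in \<open>U\<close>\<close>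
  define I where "I = {P. P \<subseteq> S \<and> (\<exists>R\<subseteq>S. hat S R \<subseteq> U \<and> ?N (P - R))}"
  have I_intro: "P \<in> I" if "P \<subseteq> S" "R \<subseteq> S" "hat S R \<subseteq> U" "?N (P - R)" for P R
    unfolding I_def using that by (intro CollectI conjI exI[of _ R])
  have I_elim: "\<exists>R. R \<subseteq> S \<and> hat S R \<subseteq> U \<and> ?N (P - R)" and I_sub: "P \<subseteq> S" if "P \<in> I" for P
    using that unfolding I_def mem_Collect_eq by - (rule conjunct2, assumption, rule conjunct1, assumption)
  have hat_empty: "hat S {} \<subseteq> U" by (auto simp: hat_def beta_def ultrafilter_on_empty)
  have "set_ideal S I"
    unfolding set_ideal_def
  proof (intro conjI ballI allI impI)
    show "S \<notin> I"
    proof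
      assume "S \<in> I"
      then obtain R where R: "R \<subseteq> S" "hat S R \<subseteq> U" "?N (S - R)" using I_elim by metis
      then show False using none[of "S - R"] by (simp add: double_diff)
    qed
    show "{} \<in> I" using null(1) hat_empty by (intro I_intro[of _ "{}"]) simp_all
    show "I \<subseteq> Pow S" using I_sub by blast
    fix P P' assume P: "P \<in> I"
    obtain R where R: "R \<subseteq> S" "hat S R \<subseteq> U" "?N (P - R)" using I_elim[OF P] by (elim exE conjE)
    show "P \<union> P' \<in> I" if P': "P' \<in> I"
    proof -
      obtain R' where R': "R' \<subseteq> S" "hat S R' \<subseteq> U" "?N (P' - R')" using I_elim[OF P'] by (elim exE conjE)
      have "hat S (R \<union> R') \<subseteq> hat S R \<union> hat S R'"
        using ultrafilter_on_Un[OF _ R(1) R'(1)] by (auto simp: hat_def beta_def)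
      then have "hat S (R \<union> R') \<subseteq> U" using R(2) R'(2) by blast
      \<comment> \<open>This difference is contained in \<open>(P - R) \<union> (P' - R')\<close>, a
        union of two null sets.\<close>
      moreover have "?N ((P \<union> P') - (R \<union> R'))"
        by (rule null(3)[OF null(2)[OF R(3) R'(3)]]) blast
      moreover have "P \<union> P' \<subseteq> S" "R \<union> R' \<subseteq> S" using I_sub[OF P] I_sub[OF P'] R(1) R'(1) by simp_all
      ultimately show ?thesis by (intro I_intro)
    qed
    show "P' \<in> I" if "P' \<subseteq> P"
    proof -
      have "?N (P' - R)" by (rule null(3)[OF R(3)]) (use that in blast)
      moreover have "P' \<subseteq> S" using I_sub[OF P] that by simp
      ultimately show ?thesis using R(1,2) by (intro I_intro)
    qed
  qed
  then obtain \<nu> where \<nu>: "\<nu> \<in> beta S" "\<nu> \<inter> I = {}"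
    by (rule set_ideal_avoiding_ultrafilter)
  have uf: "ultrafilter_on S \<nu>" using \<nu>(1) by (simp add: beta_def)
  have "\<not> ?N Q" if Q: "Q \<in> \<nu>" for Q
  proof
    assume "?N Q"
    then have "Q \<in> I"
      using ultrafilter_on_subset[OF uf Q] hat_empty by (intro I_intro[of _ "{}"]) simp_all
    then show False using \<nu>(2) Q by blast
  qed
  then have "\<nu> \<in> set_ultralimit T S c \<mu>"
    using \<nu>(1) unfolding set_ultralimit_def by blast
  then obtain R where R: "R \<subseteq> S" "\<nu> \<in> hat S R" "hat S R \<subseteq> U"
    using openin_beta_topologyE[OF U subsetD[OF sub]] by metis
  \<comment> \<open>With itself as witness, \<open>R\<close> belongs to \<open>I\<close>, although
    \<nu> contains \<open>R\<close> and avoids \<open>I\<close>.\<close>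
  have "?N (R - R)" using null(1) by simp
  then have "R \<in> I" using R(1,3) by (intro I_intro)
  then show False using R(2) \<nu>(2) by (auto simp: hat_def)
qed

text \<open>The ultralimit is cut out of \<open>beta S\<close> by the closed conditions
  \<open>hat S (S - Q)\<close>, one for each null \<open>Q\<close>.\<close>

lemma closedin_set_ultralimit:
  "closedin (beta_topology S) (set_ultralimit T S c \<mu>)"
proof -
  have "set_ultralimit T S c \<mu> =
      beta S \<inter> (\<Inter>Q\<in>{Q. Q \<subseteq> S \<and> {w \<in> T. c w \<inter> Q \<noteq> {}} \<notin> \<mu>}. hat S (S - Q))"
  proof (intro equalityI subsetI)
    fix \<nu> assume "\<nu> \<in> set_ultralimit T S c \<mu>"
    then show "\<nu> \<in> beta S \<inter> (\<Inter>Q\<in>{Q. Q \<subseteq> S \<and> {w \<in> T. c w \<inter> Q \<noteq> {}} \<notin> \<mu>}. hat S (S - Q))"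
      by (auto simp: set_ultralimit_def hat_Diff) (auto simp: hat_def)
  next
    fix \<nu> assume \<nu>: "\<nu> \<in> beta S \<inter> (\<Inter>Q\<in>{Q. Q \<subseteq> S \<and> {w \<in> T. c w \<inter> Q \<noteq> {}} \<notin> \<mu>}. hat S (S - Q))"
    then have uf: "ultrafilter_on S \<nu>" by (simp add: beta_def)
    have "{w \<in> T. c w \<inter> Q \<noteq> {}} \<in> \<mu>" if "Q \<in> \<nu>" for Q
    proof (rule ccontr)
      assume "{w \<in> T. c w \<inter> Q \<noteq> {}} \<notin> \<mu>"
      moreover have "Q \<subseteq> S" using ultrafilter_on_subset[OF uf that] .
      ultimately have "\<nu> \<in> hat S (S - Q)" using \<nu> by blast
      then show False using hat_Diff[OF \<open>Q \<subseteq> S\<close>] that by (auto simp: hat_def)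
    qed
    then show "\<nu> \<in> set_ultralimit T S c \<mu>" using \<nu> by (simp add: set_ultralimit_def)
  qed
  \<comment> \<open>As \<mu> is arbitrary here, there might be no null \<open>Q\<close>; inserting
    \<open>beta S\<close> keeps the intersected family nonempty.\<close>
  moreover have "closedin (beta_topology S)
      (\<Inter>(insert (beta S) ((\<lambda>Q. hat S (S - Q)) ` {Q. Q \<subseteq> S \<and> {w \<in> T. c w \<inter> Q \<noteq> {}} \<notin> \<mu>})))"
  proof (rule closedin_Inter)
    fix D assume "D \<in> insert (beta S) ((\<lambda>Q. hat S (S - Q)) ` {Q. Q \<subseteq> S \<and> {w \<in> T. c w \<inter> Q \<noteq> {}} \<notin> \<mu>})"
    then show "closedin (beta_topology S) D"
      using closedin_topspace[of "beta_topology S"] by (auto intro: closedin_hat)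
  qed simp
  ultimately show ?thesis by simp
qed

text \<open>An ultrafilter all of whose members meet \<open>c w\<close> cannot contain
  \<open>S - c w\<close>, hence contains \<open>c w\<close>.\<close>

lemma set_ultralimit_principal_uf:
  assumes "w \<in> T" "c w \<subseteq> S"
  shows "set_ultralimit T S c (principal_uf T w) = hat S (c w)"
proof -
  have "(\<forall>Q\<in>\<nu>. c w \<inter> Q \<noteq> {}) \<longleftrightarrow> c w \<in> \<nu>" if "\<nu> \<in> beta S" for \<nu>
  proof -
    have uf: "ultrafilter_on S \<nu>" using that by (simp add: beta_def)
    show ?thesis
    proof
      assume "\<forall>Q\<in>\<nu>. c w \<inter> Q \<noteq> {}"
      then have "S - c w \<notin> \<nu>" by blast
      then show "c w \<in> \<nu>" using ultrafilter_on_cases[OF uf assms(2)] by blast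
    next
      assume "c w \<in> \<nu>"
      then show "\<forall>Q\<in>\<nu>. c w \<inter> Q \<noteq> {}"
        using ultrafilter_on_Int[OF uf] ultrafilter_on_empty[OF uf] by metis
    qed
  qed
  then show ?thesis
    using assms(1) by (auto simp: set_ultralimit_def principal_uf_def hat_def)
qed

text \<open>The singleton of \<open>p\<close> is the least member of its principal ultrafilter, so
  testing that one set suffices.\<close>

lemma principal_uf_in_set_ultralimit_iff:
  assumes \<mu>: "\<mu> \<in> beta T" and p: "p \<in> S"
  shows "principal_uf S p \<in> set_ultralimit T S c \<mu> \<longleftrightarrow> {w \<in> T. p \<in> c w} \<in> \<mu>"
proof -
  have uf: "ultrafilter_on T \<mu>" using \<mu> by (simp add: beta_def)
  have "(\<forall>Q\<in>principal_uf S p. {w \<in> T. c w \<inter> Q \<noteq> {}} \<in> \<mu>) \<longleftrightarrow> {w \<in> T. p \<in> c w} \<in> \<mu>"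
  proof
    assume "\<forall>Q\<in>principal_uf S p. {w \<in> T. c w \<inter> Q \<noteq> {}} \<in> \<mu>"
    moreover have "{p} \<in> principal_uf S p" using p by (simp add: principal_uf_def)
    ultimately have "{w \<in> T. c w \<inter> {p} \<noteq> {}} \<in> \<mu>" by blast
    then show "{w \<in> T. p \<in> c w} \<in> \<mu>" by simp
  next
    assume L: "{w \<in> T. p \<in> c w} \<in> \<mu>"
    show "\<forall>Q\<in>principal_uf S p. {w \<in> T. c w \<inter> Q \<noteq> {}} \<in> \<mu>"
      by (intro ballI ultrafilter_on_mono[OF uf L]) (auto simp: principal_uf_def)
  qed
  then show ?thesis
    using principal_uf_in_beta[OF p] by (simp add: set_ultralimit_def)
qed

text \<open>It suffices to treat the two kinds of generating Vietoris sets. Around each point of a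
  preimage, a null set gives a clopen neighbourhood in the inclusion case, and a set that is not
  null gives one in the meeting case.\<close>

lemma continuous_map_set_ultralimit:
  "continuous_map (beta_topology T) (vietoris (beta_topology S)) (set_ultralimit T S c)"
proof -
  let ?g = "set_ultralimit T S c" and ?L = "\<lambda>Q. {w \<in> T. c w \<inter> Q \<noteq> {}}"
  have sub: "openin (beta_topology T) {\<mu> \<in> beta T. ?g \<mu> \<subseteq> U}"
    if U: "openin (beta_topology S) U" for U
  proof (subst openin_subopen, intro ballI)
    fix \<mu> assume "\<mu> \<in> {\<mu> \<in> beta T. ?g \<mu> \<subseteq> U}"
    then have \<mu>: "\<mu> \<in> beta T" "?g \<mu> \<subseteq> U" by auto
    obtain Q where Q: "Q \<subseteq> S" "hat S (S - Q) \<subseteq> U" "?L Q \<notin> \<mu>"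
      using set_ultralimit_subset_openE[OF \<mu>(1) U \<mu>(2)] by blast
    have L: "?L Q \<subseteq> T" by blast
    have "\<mu> \<in> hat T (T - ?L Q)" using \<mu>(1) Q(3) unfolding hat_Diff[OF L] by (simp add: hat_def)
    moreover have "hat T (T - ?L Q) \<subseteq> {\<mu> \<in> beta T. ?g \<mu> \<subseteq> U}"
    proof
      fix \<mu>' assume "\<mu>' \<in> hat T (T - ?L Q)"
      then have \<mu>': "\<mu>' \<in> beta T" "?L Q \<notin> \<mu>'" unfolding hat_Diff[OF L] by (auto simp: hat_def)
      then have "?g \<mu>' \<inter> hat S Q = {}"
        using set_ultralimit_meets_hat_iff[OF \<mu>'(1) Q(1)] by blast
      moreover have "?g \<mu>' \<subseteq> beta S" by (auto simp: set_ultralimit_def)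
      ultimately have "?g \<mu>' \<subseteq> hat S (S - Q)" unfolding hat_Diff[OF Q(1)] by blast
      then show "\<mu>' \<in> {\<mu> \<in> beta T. ?g \<mu> \<subseteq> U}" using \<mu>'(1) Q(2) by blast
    qed
    moreover have "openin (beta_topology T) (hat T (T - ?L Q))" by (rule openin_hat) blast
    ultimately show "\<exists>V. openin (beta_topology T) V \<and> \<mu> \<in> V \<and> V \<subseteq> {\<mu> \<in> beta T. ?g \<mu> \<subseteq> U}"
      by blast
  qed
  have meets: "openin (beta_topology T) {\<mu> \<in> beta T. ?g \<mu> \<inter> U \<noteq> {}}"
    if U: "openin (beta_topology S) U" for U
  proof (subst openin_subopen, intro ballI)
    fix \<mu> assume "\<mu> \<in> {\<mu> \<in> beta T. ?g \<mu> \<inter> U \<noteq> {}}"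
    then obtain \<nu> where \<mu>: "\<mu> \<in> beta T" and \<nu>: "\<nu> \<in> ?g \<mu>" "\<nu> \<in> U" by blast
    obtain Q where Q: "Q \<subseteq> S" "\<nu> \<in> hat S Q" "hat S Q \<subseteq> U"
      using openin_beta_topologyE[OF U \<nu>(2)] by blast
    have "\<mu> \<in> hat T (?L Q)"
      using set_ultralimit_meets_hat_iff[OF \<mu> Q(1), of c] \<mu> \<nu>(1) Q(2) by (auto simp: hat_def)
    moreover have "hat T (?L Q) \<subseteq> {\<mu> \<in> beta T. ?g \<mu> \<inter> U \<noteq> {}}"
    proof
      fix \<mu>' assume "\<mu>' \<in> hat T (?L Q)"
      then have \<mu>': "\<mu>' \<in> beta T" "?L Q \<in> \<mu>'" by (auto simp: hat_def)
      then show "\<mu>' \<in> {\<mu> \<in> beta T. ?g \<mu> \<inter> U \<noteq> {}}"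
        using set_ultralimit_meets_hat_iff[OF \<mu>'(1) Q(1), of c] Q(3) by blast
    qed
    moreover have "openin (beta_topology T) (hat T (?L Q))" by (rule openin_hat) blast
    ultimately show "\<exists>V. openin (beta_topology T) V \<and> \<mu> \<in> V \<and> V \<subseteq> {\<mu> \<in> beta T. ?g \<mu> \<inter> U \<noteq> {}}"
      by blast
  qed
  show ?thesis
    unfolding vietoris_def
  proof (rule continuous_on_generated_topo)
    fix W assume "W \<in> {{C. closedin (beta_topology S) C \<and> C \<subseteq> U} |U. openin (beta_topology S) U} \<union>
      {{C. closedin (beta_topology S) C \<and> C \<inter> U \<noteq> {}} |U. openin (beta_topology S) U}"
    then obtain U where U: "openin (beta_topology S) U"
      and W: "W = {C. closedin (beta_topology S) C \<and> C \<subseteq> U} \<or>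
              W = {C. closedin (beta_topology S) C \<and> C \<inter> U \<noteq> {}}"
      by blast
    have "?g -` W \<inter> topspace (beta_topology T) = {\<mu> \<in> beta T. ?g \<mu> \<subseteq> U} \<or>
          ?g -` W \<inter> topspace (beta_topology T) = {\<mu> \<in> beta T. ?g \<mu> \<inter> U \<noteq> {}}"
      using W by (auto simp: closedin_set_ultralimit)
    then show "openin (beta_topology T) (?g -` W \<inter> topspace (beta_topology T))"
      by (elim disjE) (simp_all only: sub[OF U] meets[OF U])
  next
    have "?g \<mu> \<in> topspace (vietoris (beta_topology S))" for \<mu>
      by (simp add: closedin_set_ultralimit)
    then show "?g ` topspace (beta_topology T) \<subseteq>
        \<Union> ({{C. closedin (beta_topology S) C \<and> C \<subseteq> U} |U. openin (beta_topology S) U} \<union>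
           {{C. closedin (beta_topology S) C \<and> C \<inter> U \<noteq> {}} |U. openin (beta_topology S) U})"
      unfolding vietoris_def topology_generated_by_topspace by blast
  qed
qed

section \<open>Contents of the points of the dual space\<close>

text \<open>The right-hand side is continuous in every coordinate and has the prescribed values at
  principal ultrafilters, so uniqueness of the extension identifies it with
  \<open>c_map\<close>.\<close>

lemma c_map_eq_set_ultralimit:
  "c_map A k = (\<lambda>\<mu>\<in>beta (lists A). \<lambda>a\<in>tuples k A. set_ultralimit (lists A) (Nk k) (c_word k a) \<mu>)"
  (is "_ = ?g")
  unfolding c_map_def
proof (rule beta_extension_eqI)
  show "Hausdorff_space (V_space A k)"
    unfolding V_space_def Hausdorff_space_product_topology
    by (simp add: Hausdorff_space_vietoris_beta)
  show "?g \<in> extensional (beta (lists A))" by simp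
  have "continuous_map (beta_topology (lists A)) (V_space A k)
      (\<lambda>\<mu>. \<lambda>a\<in>tuples k A. set_ultralimit (lists A) (Nk k) (c_word k a) \<mu>)"
    unfolding V_space_def continuous_map_componentwise
    by (auto simp: continuous_map_set_ultralimit)
  then show "continuous_map (beta_topology (lists A)) (V_space A k) ?g"
    by (rule continuous_map_eq) simp
  fix w assume w: "w \<in> lists A"
  have "c_word k a w \<subseteq> Nk k" for a :: "nat \<Rightarrow> 'a" by (auto simp: c_word_def)
  then show "?g (principal_uf (lists A) w) = (\<lambda>a\<in>tuples k A. hat (Nk k) (c_word k a w))"
    using principal_uf_in_beta[OF w] by (simp add: set_ultralimit_principal_uf[OF w])
qed

theorem mainTheorem6:
  fixes A :: "'a set" and k :: nat
    and C :: "(nat \<Rightarrow> 'a) \<Rightarrow> (nat \<Rightarrow> nat) set set set"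
  assumes "finite A" and "k \<ge> 1" and "C \<in> X_space A k"
  shows "(\<forall>p\<in>tuples k (UNIV :: nat set). \<forall>a\<in>tuples k A.
            p \<in> Cont k (C a) \<longleftrightarrow>
            (\<forall>j\<in>{1..k}. const_tuple k (p j) \<in> Cont k (C (const_tuple k (a j))))) \<and>
         disjoint_family_on (C_nat k C) A \<and>
         downset (\<Union>a\<in>A. C_nat k C a) \<and>
         (\<forall>a\<in>tuples k A. Cont k (C a) = (\<Pi>\<^sub>E j\<in>{1..k}. C_nat k C (a j)))"
proof -
  obtain \<mu> where \<mu>: "\<mu> \<in> beta (lists A)" and C: "C = c_map A k \<mu>"
    using assms(3) unfolding X_space_def by blast
  have uf: "ultrafilter_on (lists A) \<mu>" using \<mu> by (simp add: beta_def)
  \<comment> \<open>All contents of \<open>C\<close> will be expressed through the single question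
    which languages \<open>L n b\<close> belong to \<mu>.\<close>
  define L where "L = (\<lambda>n b. {w \<in> lists A. n < length w \<and> w ! n = b})"
  have L_sub: "L n b \<subseteq> lists A" for n b by (auto simp: L_def)
  have Cont_iff: "p \<in> Cont k (C a) \<longleftrightarrow> (\<forall>j\<in>{1..k}. L (p j) (a j) \<in> \<mu>)"
    if "p \<in> Nk k" "a \<in> tuples k A" for p a
  proof -
    have "p \<in> Cont k (C a) \<longleftrightarrow> {w \<in> lists A. p \<in> c_word k a w} \<in> \<mu>"
      using that \<mu> unfolding Cont_def C c_map_eq_set_ultralimit
      by (simp add: principal_uf_in_set_ultralimit_iff)
    also have "{w \<in> lists A. p \<in> c_word k a w} =
        {w \<in> lists A. \<forall>j\<in>{1..k}. p j < length w \<and> w ! p j = a j}"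
      using that by (auto simp: c_word_def)
    finally show ?thesis
      unfolding L_def ultrafilter_on_ball[OF uf finite_atLeastAtMost] .
  qed
  \<comment> \<open>For constant tuples all \<open>k\<close> conditions coincide, and
    \<open>k \<ge> 1\<close> ensures that there is at least one.\<close>
  have const_iff: "const_tuple k n \<in> Cont k (C (const_tuple k b)) \<longleftrightarrow> L n b \<in> \<mu>"
    if "b \<in> A" for n b
  proof -
    have "const_tuple k n \<in> Nk k" "const_tuple k b \<in> tuples k A"
      using that by (auto simp: const_tuple_def tuples_def)
    from Cont_iff[OF this] show ?thesis using assms(2) by (auto simp: const_tuple_def)
  qed
  \<comment> \<open>The tuple behind a member of \<open>C_nat\<close> need not be constant, but its
    condition at index \<open>1\<close> is enough. Conversely the constant tuple serves as
    witness.\<close>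
  have C_nat_iff: "n \<in> C_nat k C b \<longleftrightarrow> L n b \<in> \<mu>" if b: "b \<in> A" for n b
  proof
    assume "n \<in> C_nat k C b"
    then obtain p where p: "p \<in> Cont k (C (const_tuple k b))" "n = p 1"
      unfolding C_nat_def by blast
    moreover have "p \<in> Nk k" "const_tuple k b \<in> tuples k A"
      using p(1) b by (auto simp: Cont_def const_tuple_def tuples_def)
    ultimately show "L n b \<in> \<mu>"
      using Cont_iff[of p "const_tuple k b"] assms(2) by (auto simp: const_tuple_def)
  next
    assume "L n b \<in> \<mu>"
    then have "const_tuple k n \<in> Cont k (C (const_tuple k b))" using const_iff[OF b] by simp
    moreover have "const_tuple k n 1 = n" using assms(2) by (simp add: const_tuple_def)
    ultimately show "n \<in> C_nat k C b" unfolding C_nat_def by (metis image_eqI)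
  qed
  have "p \<in> Cont k (C a) \<longleftrightarrow>
      (\<forall>j\<in>{1..k}. const_tuple k (p j) \<in> Cont k (C (const_tuple k (a j))))"
    if "p \<in> Nk k" "a \<in> tuples k A" for p a
  proof -
    have "a j \<in> A" if "j \<in> {1..k}" for j
      using that \<open>a \<in> tuples k A\<close> unfolding tuples_def by (rule PiE_mem[rotated])
    then show ?thesis unfolding Cont_iff[OF that] using const_iff by blast
  qed
  moreover have "disjoint_family_on (C_nat k C) A"
    unfolding disjoint_family_on_def
  proof (intro ballI impI)
    fix a b assume ab: "a \<in> A" "b \<in> A" "a \<noteq> b"
    \<comment> \<open>A word has only one letter at position \<open>n\<close>.\<close>
    have "L n a \<inter> L n b = {}" for n using ab(3) by (auto simp: L_def)
    then have "\<not> (L n a \<in> \<mu> \<and> L n b \<in> \<mu>)" for n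
      using ultrafilter_on_Int[OF uf] ultrafilter_on_empty[OF uf] by metis
    then show "C_nat k C a \<inter> C_nat k C b = {}" using C_nat_iff ab(1,2) by blast
  qed
  moreover have "downset (\<Union>a\<in>A. C_nat k C a)"
    unfolding downset_def
  proof (intro ballI allI impI)
    fix n m assume "n \<in> (\<Union>a\<in>A. C_nat k C a)" and mn: "m \<le> n"
    then obtain a where "a \<in> A" "L n a \<in> \<mu>" using C_nat_iff by blast
    \<comment> \<open>A word reaching position \<open>n\<close> also has some letter of
      \<open>A\<close> at the earlier position \<open>m\<close>. The union on the right is finite,
      so one of its members lies in \<mu>.\<close>
    moreover have "L n a \<subseteq> (\<Union>b\<in>A. L m b)"
    proof
      fix w assume "w \<in> L n a"
      then have w: "w \<in> lists A" "m < length w" using mn by (auto simp: L_def)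
      then have "w ! m \<in> A" using nth_mem by (metis in_lists_conv_set)
      then show "w \<in> (\<Union>b\<in>A. L m b)" using w by (auto simp: L_def)
    qed
    ultimately have "(\<Union>b\<in>A. L m b) \<in> \<mu>"
      using ultrafilter_on_mono[OF uf] L_sub by (metis UN_least)
    then obtain b where "b \<in> A" "L m b \<in> \<mu>"
      using ultrafilter_on_UN[OF uf assms(1)] L_sub by meson
    then show "m \<in> (\<Union>a\<in>A. C_nat k C a)" using C_nat_iff by blast
  qed
  moreover have "Cont k (C a) = (\<Pi>\<^sub>E j\<in>{1..k}. C_nat k C (a j))" if a: "a \<in> tuples k A" for a
  proof -
    have aA: "a j \<in> A" if "j \<in> {1..k}" for j
      using that a unfolding tuples_def by (rule PiE_mem[rotated])
    have "p \<in> Cont k (C a) \<longleftrightarrow> p \<in> (\<Pi>\<^sub>E j\<in>{1..k}. C_nat k C (a j))" for p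
    proof (cases "p \<in> Nk k")
      case True
      then have "p \<in> extensional {1..k}" by (simp add: tuples_def PiE_def)
      then show ?thesis
        unfolding Cont_iff[OF True a] using aA C_nat_iff by (simp add: PiE_iff)
    next
      \<comment> \<open>Neither side contains such a \<open>p\<close>: members of the product are
        extensional on \<open>{1..k}\<close> and so already lie in \<open>Nk k\<close>.\<close>
      case False
      then show ?thesis by (auto simp: Cont_def tuples_def PiE_iff)
    qed
    then show ?thesis by blast
  qed
  ultimately show ?thesis by blast
qed

end
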